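(* As formal power series in $x$ with rational coefficients, the following two identities hold: (a) $\displaystyle A(-1;x)=\frac{\frac{d}{dx}F(x)}{F(x)}$; (b) $\displaystyle P^{\mathsf{pk}}(-1;x)=\frac{\frac{d}{dx}G(x)}{G(x)}$.
   Context: Let $\mathfrak{S}_n$ be the set of permutations $\pi=\pi_1\pi_2\cdots\pi_n$ (one-line notation) of $[n]=\{1,\dots,n\}$. A letter $\pi_i$ with $1\le i\le n-1$ is a descent of $\pi$ if $\pi_i>\pi_{i+1}$; a letter $\pi_i$ with $2\le i\le n-1$ is a peak of $\pi$ if $\pi_{i-1}<\pi_i>\pi_{i+1}$. Let $\mathsf{des}(\pi)$ and $\mathsf{pk}(\pi)$ be the numbers of descents and peaks of $\pi$. Define $A_n(t)=\sum_{\pi\in\mathfrak{S}_n}t^{\mathsf{des}(\pi)}$ and $P_n^{\mathsf{pk}}(t)=\sum_{\pi\in\mathfrak{S}_n}t^{\mathsf{pk}(\pi)}$, with exponential generating functions (without constant term) $A(t;x)=\sum_{n\ge1}A_n(t)\frac{x^n}{n!}$ and $P^{\mathsf{pk}}(t;x)=\sum_{n\ge1}P_n^{\mathsf{pk}}(t)\frac{x^n}{n!}$. Let $f_n=1$ if $n$ is even and $f_n=0$ if $n$ is odd ($n\ge 0$), and $F(x)=\sum_{n\ge0}f_n\frac{x^n}{n!}=\cosh(x)$. Let the (shifted) Pell numbers be defined by $g_0=1$, $g_1=0$, and $g_n=2g_{n-1}+g_{n-2}$ for $n\ge2$, and let $G(x)=\sum_{n\ge0}g_n\frac{x^n}{n!}$.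 *)

theory Defs
  imports
    "HOL-Combinatorics.Multiset_Permutations"
    "HOL-Computational_Algebra.Computational_Algebra"
begin

text \<open>
  A permutation of \<open>{1..n}\<close> in one-line notation is a list in
  \<open>permutations_of_set {1..n}\<close>. List positions start at 0, so \<open>\<pi> ! i\<close> is the letter
  \<open>\<pi>\<^sub>i\<^sub>+\<^sub>1\<close>. The letters are distinct, so descents and peaks are counted by position.
\<close>

definition des :: "nat list \<Rightarrow> nat" where
  "des \<pi> = card {i. i + 1 < length \<pi> \<and> \<pi> ! i > \<pi> ! (i + 1)}"

definition pk :: "nat list \<Rightarrow> nat" where
  "pk \<pi> = card {i. 1 \<le> i \<and> i + 1 < length \<pi> \<and> \<pi> ! (i - 1) < \<pi> ! i \<and> \<pi> ! i > \<pi> ! (i + 1)}"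

definition eulerian_poly :: "nat \<Rightarrow> rat poly" where
  "eulerian_poly n = (\<Sum>\<pi>\<in>permutations_of_set {1..n}. monom 1 (des \<pi>))"

definition peak_poly :: "nat \<Rightarrow> rat poly" where
  "peak_poly n = (\<Sum>\<pi>\<in>permutations_of_set {1..n}. monom 1 (pk \<pi>))"

definition egf :: "(nat \<Rightarrow> rat) \<Rightarrow> rat fps" where
  "egf a = Abs_fps (\<lambda>n. a n / fact n)"

text \<open>The generating functions of the two polynomial families have no constant term.\<close>

definition eulerian_egf :: "rat \<Rightarrow> rat fps" where
  "eulerian_egf t = egf (\<lambda>n. if n = 0 then 0 else poly (eulerian_poly n) t)"

definition peak_egf :: "rat \<Rightarrow> rat fps" where
  "peak_egf t = egf (\<lambda>n. if n = 0 then 0 else poly (peak_poly n) t)"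

definition even_seq :: "nat \<Rightarrow> rat" where
  "even_seq n = (if even n then 1 else 0)"

fun pell :: "nat \<Rightarrow> rat" where
  "pell 0 = 1"
| "pell (Suc 0) = 0"
| "pell (Suc (Suc n)) = 2 * pell (Suc n) + pell n"

end

theory Submission
  imports Defs
begin

text \<open>
  Split a permutation as \<open>\<sigma> m \<tau>\<close> at its maximal letter \<open>m\<close>. Then \<open>des\<close> and \<open>pk\<close> are additive up
  to a correction that depends only on whether \<open>\<sigma>\<close> and \<open>\<tau>\<close> are empty, so each generating
  function \<open>y\<close> solves a Riccati equation: at \<open>t = -1\<close> it is \<open>y' = 1 - y\<^sup>2\<close> for descents and
  \<open>y' = 1 + 2 y - y\<^sup>2\<close> for peaks. The substitution \<open>y = H' / H\<close> turns these into the linear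
  equations \<open>H'' = H\<close> and \<open>H'' = 2 H' + H\<close>, which \<open>F\<close> and \<open>G\<close> satisfy.
\<close>

section \<open>Splitting at the maximum\<close>

text \<open>Peels off index 0, which turns the positional counts \<open>des\<close> and
  \<open>pk\<close> into recursions on the list.\<close>

lemma card_Collect_nat_shift:
  fixes P :: "nat \<Rightarrow> bool"
  assumes "finite {i. P (Suc i)}"
  shows "card {i. P i} = of_bool (P 0) + card {i. P (Suc i)}"
proof -
  have "{i. P i} = (if P 0 then {0} else {}) \<union> Suc ` {i. P (Suc i)}"
  proof (rule set_eqI)
    fix i show "i \<in> {i. P i} \<longleftrightarrow> i \<in> (if P 0 then {0} else {}) \<union> Suc ` {i. P (Suc i)}"
      by (cases i) auto
  qed
  moreover have "card (\<dots>) = of_bool (P 0) + card (Suc ` {i. P (Suc i)})"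
    using assms by (subst card_Un_disjoint) auto
  ultimately show ?thesis
    by (simp add: card_image)
qed

lemma des_simps [simp]:
  "des [] = 0"
  "des [x] = 0"
  "des (x # y # xs) = of_bool (x > y) + des (y # xs)"
proof -
  show "des [] = 0" "des [x] = 0"
    by (simp_all add: des_def)
  show "des (x # y # xs) = of_bool (x > y) + des (y # xs)"
    unfolding des_def by (subst card_Collect_nat_shift) auto
qed

text \<open>Indexes a peak by its left neighbour, so that removing the head of the list is a shift
  by one. Index 0 is never a peak in \<open>pk_def\<close>.\<close>

lemma pk_altdef:
  "pk xs = card {i. i + 2 < length xs \<and> xs ! i < xs ! (i + 1) \<and> xs ! (i + 1) > xs ! (i + 2)}"
  unfolding pk_def
  by (subst card_Collect_nat_shift) (auto intro: finite_subset[of _ "{..<length xs}"])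

lemma pk_simps [simp]:
  "pk [] = 0"
  "pk [x] = 0"
  "pk [x, y] = 0"
  "pk (x # y # z # xs) = of_bool (x < y \<and> y > z) + pk (y # z # xs)"
proof -
  show "pk [] = 0" "pk [x] = 0" "pk [x, y] = 0"
    by (simp_all add: pk_altdef)
  show "pk (x # y # z # xs) = of_bool (x < y \<and> y > z) + pk (y # z # xs)"
    unfolding pk_altdef by (subst card_Collect_nat_shift) auto
qed

text \<open>The last letter of \<open>\<sigma>\<close> is followed by the larger \<open>m\<close>,
  so no descent arises there; \<open>m\<close> is itself a descent as soon as a letter follows
  it.\<close>

lemma des_append_max:
  assumes "\<forall>x\<in>set \<sigma> \<union> set \<tau>. x < m"
  shows "des (\<sigma> @ m # \<tau>) = des \<sigma> + des \<tau> + of_bool (\<tau> \<noteq> [])"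
  using assms
proof (induction \<sigma> rule: induct_list012)
  case 1
  then show ?case by (cases \<tau>) auto
next
  case (2 x)
  then show ?case by (cases \<tau>) auto
next
  case (3 x y zs)
  then show ?case by simp
qed

lemma pk_Cons_max:
  assumes "\<forall>x\<in>set \<tau>. x < m"
  shows "pk (m # \<tau>) = pk \<tau>"
  using assms by (induction \<tau> rule: induct_list012) auto

text \<open>The neighbours of \<open>m\<close> cannot be peaks, and as end letters of
  \<open>\<sigma>\<close> and \<open>\<tau>\<close> they are not counted there either. Only
  \<open>m\<close> can be a new peak, and it needs a neighbour on both sides.\<close>

lemma pk_append_max:
  assumes "\<forall>x\<in>set \<sigma> \<union> set \<tau>. x < m"
  shows "pk (\<sigma> @ m # \<tau>) = pk \<sigma> + pk \<tau> + of_bool (\<sigma> \<noteq> [] \<and> \<tau> \<noteq> [])"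
  using assms
proof (induction \<sigma> rule: induct_list012)
  case 1
  then show ?case by (simp add: pk_Cons_max)
next
  case (2 x)
  then show ?case using pk_Cons_max[of \<tau> m] by (cases \<tau>) auto
next
  case (3 x y zs)
  then show ?case by (cases zs) auto
qed

text \<open>Since \<open>m\<close> occurs exactly once, the place of the cut is unique;
  \<open>B\<close> is the set of letters to its left.\<close>

lemma bij_betw_permutations_split:
  assumes "m \<in> S"
  shows "bij_betw (\<lambda>(B, \<sigma>, \<tau>). \<sigma> @ m # \<tau>)
           (SIGMA B:Pow (S - {m}). permutations_of_set B \<times> permutations_of_set (S - {m} - B))
           (permutations_of_set S)"
  unfolding bij_betw_def
proof (intro conjI set_eqI iffI)
  show "inj_on (\<lambda>(B, \<sigma>, \<tau>). \<sigma> @ m # \<tau>)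
    (SIGMA B:Pow (S - {m}). permutations_of_set B \<times> permutations_of_set (S - {m} - B))"
    by (auto simp: inj_on_def permutations_of_set_def append_eq_append_conv2 Cons_eq_append_conv
        append_eq_Cons_conv)
next
  fix \<pi>
  assume "\<pi> \<in> (\<lambda>(B, \<sigma>, \<tau>). \<sigma> @ m # \<tau>) `
    (SIGMA B:Pow (S - {m}). permutations_of_set B \<times> permutations_of_set (S - {m} - B))"
  then show "\<pi> \<in> permutations_of_set S"
    using assms by (auto simp: permutations_of_set_def)
next
  fix \<pi>
  assume \<pi>: "\<pi> \<in> permutations_of_set S"
  then obtain \<sigma> \<tau> where "\<pi> = \<sigma> @ m # \<tau>"
    using assms by (metis permutations_of_setD(1) split_list)
  with \<pi> have "(set \<sigma>, \<sigma>, \<tau>) \<in>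
      (SIGMA B:Pow (S - {m}). permutations_of_set B \<times> permutations_of_set (S - {m} - B))"
    by (auto simp: permutations_of_set_def)
  with \<open>\<pi> = \<sigma> @ m # \<tau>\<close> show "\<pi> \<in> (\<lambda>(B, \<sigma>, \<tau>). \<sigma> @ m # \<tau>) `
    (SIGMA B:Pow (S - {m}). permutations_of_set B \<times> permutations_of_set (S - {m} - B))"
    by (intro image_eqI[where x = "(set \<sigma>, \<sigma>, \<tau>)"]) auto
qed

lemma sum_Pow_card:
  fixes f :: "nat \<Rightarrow> 'a::comm_semiring_1"
  assumes "finite A"
  shows "(\<Sum>B\<in>Pow A. f (card B)) = (\<Sum>k\<le>card A. of_nat (card A choose k) * f k)"
proof -
  have "(\<Sum>B\<in>Pow A. f (card B)) = (\<Sum>k\<le>card A. \<Sum>B | B \<in> Pow A \<and> card B = k. f (card B))"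
    using assms by (intro sum.group [symmetric]) (auto intro: card_mono)
  also have "\<dots> = (\<Sum>k\<le>card A. of_nat (card A choose k) * f k)"
    using n_subsets[OF assms] by (intro sum.cong) auto
  finally show ?thesis .
qed

section \<open>The Riccati equation\<close>

text \<open>Induction over arbitrary finite sets, because the letters on either side of the maximum
  need not form an interval. The arguments of \<open>c\<close> say whether the left and right parts
  are empty. Dividing by factorials turns the binomial convolution into a Cauchy product, and the
  four emptiness cases become the terms of the Riccati equation. The summand 1 in
  \<open>1 + y\<close> is the empty permutation.\<close>

lemma sum_permutations_multiplicative:
  fixes w :: "'a::linorder list \<Rightarrow> rat" and c :: "bool \<Rightarrow> bool \<Rightarrow> rat" and y :: "rat fps"
  assumes w_Nil: "w [] = 1"
    and w_split: "\<And>\<sigma> m \<tau>. \<forall>x\<in>set \<sigma> \<union> set \<tau>. x < m \<Longrightarrow>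
           w (\<sigma> @ m # \<tau>) = c (\<sigma> = []) (\<tau> = []) * w \<sigma> * w \<tau>"
    and y0: "y $ 0 = 0"
    and riccati: "fps_deriv y = fps_const (c True True)
           + fps_const (c True False + c False True) * y + fps_const (c False False) * y ^ 2"
    and "finite S"
  shows "(\<Sum>\<pi>\<in>permutations_of_set S. w \<pi>) = fact (card S) * (1 + y) $ card S"
  using \<open>finite S\<close>
proof (induction S rule: finite_psubset_induct)
  case (psubset S)
  show ?case
  proof (cases "S = {}")
    case True
    then show ?thesis by (simp add: w_Nil y0)
  next
    case False
    define m where "m = Max S"
    define n where "n = card (S - {m})"
    have m: "m \<in> S"
      using psubset.hyps False by (simp add: m_def)
    have max: "x < m" if "x \<in> S - {m}" for x
      using psubset.hyps that by (auto simp: m_def less_le)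
    have fin: "finite (S - {m})"
      using psubset.hyps by simp
    have card_S: "card S = Suc n"
      using psubset.hyps m unfolding n_def by (metis card_Suc_Diff1)
    define z where "z = 1 + y"
    \<comment> \<open>Normalised contribution of the cuts with \<open>k\<close> letters on the left,
      used only for \<open>k \<le> n\<close>.\<close>
    define v where "v k = c (k = 0) (n - k = 0) * z $ k * z $ (n - k)" for k
    have split_term: "(\<Sum>\<sigma>\<in>permutations_of_set B. \<Sum>\<tau>\<in>permutations_of_set (S - {m} - B). w (\<sigma> @ m # \<tau>))
        = fact (card B) * fact (n - card B) * v (card B)" (is "?lhs = ?rhs")
      if "B \<in> Pow (S - {m})" for B
    proof -
      have B: "B \<subseteq> S - {m}" "finite B"
        using that fin finite_subset by auto
      have card': "card (S - {m} - B) = n - card B"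
        using B by (simp add: n_def card_Diff_subset)
      have empty1: "B = {} \<longleftrightarrow> card B = 0"
        using B by simp
      have empty2: "S - {m} - B = {} \<longleftrightarrow> n - card B = 0"
        using fin card' by (metis card_0_eq finite_Diff)
      have "?lhs = (\<Sum>\<sigma>\<in>permutations_of_set B. \<Sum>\<tau>\<in>permutations_of_set (S - {m} - B).
          c (B = {}) (S - {m} - B = {}) * w \<sigma> * w \<tau>)"
      proof (intro sum.cong refl)
        fix \<sigma> \<tau>
        assume "\<sigma> \<in> permutations_of_set B" "\<tau> \<in> permutations_of_set (S - {m} - B)"
        then have sets: "set \<sigma> = B" "set \<tau> = S - {m} - B"
          by (auto dest: permutations_of_setD)
        then have "\<forall>x\<in>set \<sigma> \<union> set \<tau>. x < m"
          using B max by auto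
        moreover have "\<sigma> = [] \<longleftrightarrow> B = {}" "\<tau> = [] \<longleftrightarrow> S - {m} - B = {}"
          using sets by (metis set_empty)+
        ultimately show "w (\<sigma> @ m # \<tau>) = c (B = {}) (S - {m} - B = {}) * w \<sigma> * w \<tau>"
          using w_split by simp
      qed
      also have "\<dots> = c (card B = 0) (n - card B = 0) * (\<Sum>\<sigma>\<in>permutations_of_set B. w \<sigma>) *
          (\<Sum>\<tau>\<in>permutations_of_set (S - {m} - B). w \<tau>)"
        unfolding empty1 empty2 mult.assoc sum_product by (simp add: sum_distrib_left)
      \<comment> \<open>Both \<open>B\<close> and its complement in \<open>S - {m}\<close> miss
        \<open>m\<close>, so they are proper subsets of \<open>S\<close> and the induction
        hypothesis applies.\<close>
      also have "(\<Sum>\<sigma>\<in>permutations_of_set B. w \<sigma>) = fact (card B) * z $ card B"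
        unfolding z_def using B m by (intro psubset.IH) auto
      also have "(\<Sum>\<tau>\<in>permutations_of_set (S - {m} - B). w \<tau>) = fact (n - card B) * z $ (n - card B)"
        unfolding z_def card'[symmetric] using m by (intro psubset.IH) auto
      finally show ?thesis
        by (simp add: v_def)
    qed
    have "(\<Sum>\<pi>\<in>permutations_of_set S. w \<pi>) =
        (\<Sum>(B, \<sigma>, \<tau>)\<in>(SIGMA B:Pow (S - {m}). permutations_of_set B \<times> permutations_of_set (S - {m} - B)).
          w (\<sigma> @ m # \<tau>))"
      using sum.reindex_bij_betw[OF bij_betw_permutations_split[OF m], of w]
      by (simp add: case_prod_unfold)
    also have "\<dots> = (\<Sum>B\<in>Pow (S - {m}). \<Sum>\<sigma>\<in>permutations_of_set B.
        \<Sum>\<tau>\<in>permutations_of_set (S - {m} - B). w (\<sigma> @ m # \<tau>))"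
      using fin by (subst sum.Sigma [symmetric]) (auto simp: sum.cartesian_product)
    also have "\<dots> = (\<Sum>B\<in>Pow (S - {m}). fact (card B) * fact (n - card B) * v (card B))"
      by (intro sum.cong refl split_term)
    also have "\<dots> = (\<Sum>k\<le>n. of_nat (n choose k) * (fact k * fact (n - k) * v k))"
      using sum_Pow_card[OF fin, of "\<lambda>k. fact k * fact (n - k) * v k"] by (simp add: n_def)
    also have "\<dots> = (\<Sum>k\<le>n. fact n * v k)"
    proof (intro sum.cong refl)
      fix k assume "k \<in> {..n}"
      then have "(fact n :: rat) = fact k * fact (n - k) * of_nat (n choose k)"
        using binomial_fact_lemma[of k n] by (metis atMost_iff of_nat_fact of_nat_mult)
      then show "of_nat (n choose k) * (fact k * fact (n - k) * v k) = fact n * v k"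
        by simp
    qed
    also have "\<dots> = fact n * (\<Sum>k\<le>n. v k)"
      by (simp add: sum_distrib_left)
    also have "(\<Sum>k\<le>n. v k) = fps_deriv y $ n"
    proof -
      \<comment> \<open>\<open>1 $ k\<close> is the indicator of \<open>k = 0\<close>, while
        \<open>y $ k\<close> vanishes there, so only the summand matching the emptiness case can
        survive.\<close>
      have v: "v k = c True True * (1 $ k * 1 $ (n - k)) + c True False * (1 $ k * y $ (n - k)) +
          c False True * (y $ k * 1 $ (n - k)) + c False False * (y $ k * y $ (n - k))" for k
        by (cases "k = 0"; cases "n - k = 0") (simp_all add: v_def z_def y0)
      \<comment> \<open>The factors 1 are kept so that all four terms expand as Cauchy
        products.\<close>
      have "fps_deriv y = fps_const (c True True) * (1 * 1) + fps_const (c True False) * (1 * y) +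
          fps_const (c False True) * (y * 1) + fps_const (c False False) * (y * y)"
        unfolding riccati by (simp add: power2_eq_square algebra_simps flip: fps_const_add)
      then have "fps_deriv y $ n = c True True * (1 * 1 :: rat fps) $ n + c True False * (1 * y) $ n +
          c False True * (y * 1) $ n + c False False * (y * y) $ n"
        by (simp only: fps_add_nth fps_mult_left_const_nth)
      also have "\<dots> = (\<Sum>k\<le>n. v k)"
        unfolding fps_mult_nth v by (simp only: sum.distrib sum_distrib_left atLeast0AtMost)
      finally show ?thesis ..
    qed
    finally show ?thesis
      by (simp add: card_S)
  qed
qed

lemma egf_permutations_multiplicative:
  fixes w :: "nat list \<Rightarrow> rat"
  assumes "w [] = 1"
    and "\<And>\<sigma> m \<tau>. \<forall>x\<in>set \<sigma> \<union> set \<tau>. x < m \<Longrightarrow>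
           w (\<sigma> @ m # \<tau>) = c (\<sigma> = []) (\<tau> = []) * w \<sigma> * w \<tau>"
    and y0: "y $ 0 = 0"
    and "fps_deriv y = fps_const (c True True)
           + fps_const (c True False + c False True) * y + fps_const (c False False) * y ^ 2"
  shows "egf (\<lambda>n. if n = 0 then 0 else \<Sum>\<pi>\<in>permutations_of_set {1..n}. w \<pi>) = y"
proof (rule fps_ext)
  fix n
  show "egf (\<lambda>n. if n = 0 then 0 else \<Sum>\<pi>\<in>permutations_of_set {1..n}. w \<pi>) $ n = y $ n"
    using sum_permutations_multiplicative[OF assms, of "{1..n}"] y0 by (simp add: egf_def)
qed

section \<open>Logarithmic derivatives\<close>

lemma fps_deriv_log_deriv:
  fixes h :: "'a::field fps"
  assumes "h $ 0 \<noteq> 0"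
  shows "fps_deriv (fps_deriv h / h) = fps_deriv (fps_deriv h) / h - (fps_deriv h / h) ^ 2"
  using assms
  by (simp add: fps_divide_unit fps_inverse_deriv power2_eq_square algebra_simps)

lemma fps_deriv_egf: "fps_deriv (egf a) = egf (\<lambda>n. a (Suc n))"
  by (rule fps_ext) (simp add: egf_def field_simps del: of_nat_Suc)

lemma egf_nth_0 [simp]: "egf a $ 0 = a 0"
  by (simp add: egf_def)

text \<open>Dividing the linear equation by \<open>h\<close> evaluates the term
  \<open>h'' / h\<close> of the quotient rule as \<open>b * h' / h + 1\<close>.\<close>

lemma riccati_log_deriv:
  fixes h :: "'a::field fps"
  assumes "h $ 0 \<noteq> 0" and ode: "fps_deriv (fps_deriv h) = fps_const b * fps_deriv h + h"
  shows "fps_deriv (fps_deriv h / h) = fps_const 1 + fps_const b * (fps_deriv h / h)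
           + fps_const (-1) * (fps_deriv h / h) ^ 2"
  using assms(1) unfolding fps_deriv_log_deriv[OF assms(1)] ode
  by (simp add: fps_divide_unit inverse_mult_eq_1' algebra_simps flip: fps_const_neg)

theorem theorem1:
  "eulerian_egf (-1) = fps_deriv (egf even_seq) / egf even_seq \<and>
   peak_egf (-1) = fps_deriv (egf pell) / egf pell"
proof
  have "fps_deriv (fps_deriv (egf even_seq)) = fps_const 0 * fps_deriv (egf even_seq) + egf even_seq"
    unfolding fps_deriv_egf by (rule fps_ext) (simp add: egf_def even_seq_def)
  then have "fps_deriv (fps_deriv (egf even_seq) / egf even_seq) =
      fps_const 1 + fps_const 0 * (fps_deriv (egf even_seq) / egf even_seq)
        + fps_const (-1) * (fps_deriv (egf even_seq) / egf even_seq) ^ 2"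
    by (intro riccati_log_deriv) (simp add: even_seq_def)
  then have "egf (\<lambda>n. if n = 0 then 0 else \<Sum>\<pi>\<in>permutations_of_set {1..n}. (-1) ^ des \<pi>) =
      fps_deriv (egf even_seq) / egf even_seq"
    \<comment> \<open>The sign is -1 exactly when \<open>m\<close> is a descent. The mixed cases
      cancel, which leaves no linear term; \<open>even_seq 1 = 0\<close> gives the initial
      value.\<close>
    by (intro egf_permutations_multiplicative[where c = "\<lambda>_ q. if q then 1 else -1"])
      (auto simp: des_append_max power_add fps_deriv_egf fps_divide_unit even_seq_def)
  then show "eulerian_egf (-1) = fps_deriv (egf even_seq) / egf even_seq"
    by (simp add: eulerian_egf_def eulerian_poly_def poly_sum poly_monom cong: if_cong)
next
  have "egf pell $ 0 \<noteq> 0"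
    by simp
  moreover have "fps_deriv (fps_deriv (egf pell)) = fps_const 2 * fps_deriv (egf pell) + egf pell"
    unfolding fps_deriv_egf by (rule fps_ext) (simp add: egf_def add_divide_distrib)
  ultimately have "fps_deriv (fps_deriv (egf pell) / egf pell) =
      fps_const 1 + fps_const 2 * (fps_deriv (egf pell) / egf pell)
        + fps_const (-1) * (fps_deriv (egf pell) / egf pell) ^ 2"
    by (rule riccati_log_deriv)
  then have "egf (\<lambda>n. if n = 0 then 0 else \<Sum>\<pi>\<in>permutations_of_set {1..n}. (-1) ^ pk \<pi>) =
      fps_deriv (egf pell) / egf pell"
    \<comment> \<open>The sign is -1 exactly when \<open>m\<close> is a peak. The mixed cases add up
      to the coefficient 2 of the Pell recurrence; \<open>pell 1 = 0\<close> gives the initial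
      value.\<close>
    by (intro egf_permutations_multiplicative[where c = "\<lambda>p q. if p \<or> q then 1 else -1"])
      (auto simp: pk_append_max power_add fps_deriv_egf fps_divide_unit)
  then show "peak_egf (-1) = fps_deriv (egf pell) / egf pell"
    by (simp add: peak_egf_def peak_poly_def poly_sum poly_monom cong: if_cong)
qed

end
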